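(* Let $(X,\tau)$ and $(Y,\delta)$ be topological spaces, let $T:P(X)\to P(X)$ be the operator $T(A)=\mathrm{Int}(\mathrm{Cl}(A))$ for $A\subseteq X$, and let $f:(X,\tau,T)\to(Y,\delta)$ be a function. Then $f$ is weakly almost contra-$T^*$-continuous if and only if, whenever $S$ is a regular closed subset of $Y$, $V$ is a regular open subset of $Y$, and $S\subseteq V$, one has $\mathrm{Cl}(\mathrm{Int}(f^{-1}(S)))\subseteq f^{-1}(V)$.
   Context: $P(X)$ is the power set of $X$; $\mathrm{Cl}$ and $\mathrm{Int}$ denote closure and interior. A set $A$ is regular open if $A=\mathrm{Int}(\mathrm{Cl}(A))$ and regular closed if $A=\mathrm{Cl}(\mathrm{Int}(A))$. An operator topological space $(X,\tau,T)$ is a topological space $(X,\tau)$ with a function $T:P(X)\to P(X)$ such that $U\subseteq T(U)$ for all $U\in\tau$ (the operator $T(A)=\mathrm{Int}(\mathrm{Cl}(A))$ has this property). A set $A\subseteq X$ (not necessarily open) is $T^*$-open if $A\subseteq T(A)$, and $T^*$-closed if its complement is $T^*$-open. $T^*\mathrm{Cl}(A)$ is the intersection of all $T^*$-closed sets containing $A$. A function $f:(X,\tau,T)\to(Y,\delta)$, with $(Y,\delta)$ a topological space, is weakly almost contra-$T^*$-continuous if for every regular open $V\subseteq Y$ and every regular closed $S\subseteq Y$ with $S\subseteq V$, one has $T^*\mathrm{Cl}(f^{-1}(S))\subseteq f^{-1}(V)$. *)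

theory Defs
  imports "HOL-Analysis.Analysis"
begin

text \<open>The underlying set of a space \<open>X\<close> is \<open>topspace X\<close>, so an operator
  \<open>P(X) \<rightarrow> P(X)\<close> is a function on sets considered only on subsets of \<open>topspace X\<close>.\<close>

definition regular_openin :: "'a topology \<Rightarrow> 'a set \<Rightarrow> bool" where
  "regular_openin X A \<longleftrightarrow> A = X interior_of (X closure_of A)"

definition regular_closedin :: "'a topology \<Rightarrow> 'a set \<Rightarrow> bool" where
  "regular_closedin X A \<longleftrightarrow> A = X closure_of (X interior_of A)"

definition operator_topological_space :: "'a topology \<Rightarrow> ('a set \<Rightarrow> 'a set) \<Rightarrow> bool" where
  "operator_topological_space X T \<longleftrightarrow>
     T \<in> Pow (topspace X) \<rightarrow> Pow (topspace X) \<and> (\<forall>U. openin X U \<longrightarrow> U \<subseteq> T U)"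

definition T_star_openin :: "'a topology \<Rightarrow> ('a set \<Rightarrow> 'a set) \<Rightarrow> 'a set \<Rightarrow> bool" where
  "T_star_openin X T A \<longleftrightarrow> A \<subseteq> topspace X \<and> A \<subseteq> T A"

definition T_star_closedin :: "'a topology \<Rightarrow> ('a set \<Rightarrow> 'a set) \<Rightarrow> 'a set \<Rightarrow> bool" where
  "T_star_closedin X T A \<longleftrightarrow> A \<subseteq> topspace X \<and> T_star_openin X T (topspace X - A)"

text \<open>For \<open>A \<subseteq> topspace X\<close> the family below contains \<open>topspace X\<close>, because the empty set is
  always \<open>T\<^sup>*\<close>-open; hence the intersection is never taken over the empty family.\<close>

definition T_star_closure_of ::
    "'a topology \<Rightarrow> ('a set \<Rightarrow> 'a set) \<Rightarrow> 'a set \<Rightarrow> 'a set" where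
  "T_star_closure_of X T A = \<Inter>{F. T_star_closedin X T F \<and> A \<subseteq> F}"

text \<open>As in the library's \<open>continuous_map\<close>, the definition includes that \<open>f\<close> maps
  \<open>topspace X\<close> to \<open>topspace Y\<close>, and preimages are taken within \<open>topspace X\<close>.\<close>

definition weakly_almost_contra_T_star_continuous_map ::
    "'a topology \<Rightarrow> ('a set \<Rightarrow> 'a set) \<Rightarrow> 'b topology \<Rightarrow> ('a \<Rightarrow> 'b) \<Rightarrow> bool" where
  "weakly_almost_contra_T_star_continuous_map X T Y f \<longleftrightarrow>
     operator_topological_space X T \<and>
     f \<in> topspace X \<rightarrow> topspace Y \<and>
     (\<forall>V S. regular_openin Y V \<and> regular_closedin Y S \<and> S \<subseteq> V \<longrightarrow>
        T_star_closure_of X T {x \<in> topspace X. f x \<in> S} \<subseteq> {x \<in> topspace X. f x \<in> V})"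

end

theory Submission
  imports Defs
begin

text \<open>For \<open>T A = Int (Cl A)\<close> the \<open>T\<^sup>*\<close>-open sets are the preopen sets, and the
  preclosure of \<open>A\<close> is \<open>A \<union> Cl (Int A)\<close>. Taking \<open>A\<close> to be the preimage of \<open>S\<close>,
  the part \<open>A\<close> lies in the preimage of \<open>V\<close> because \<open>S \<subseteq> V\<close>, so only \<open>Cl (Int A)\<close> matters.\<close>

text \<open>Outside \<open>C\<close>, a point of the left side lies in an open set contained in
  \<open>A\<close>, hence in the interior of \<open>A\<close>.\<close>

lemma interior_of_Un_closedin_subset:
  assumes "closedin X C"
  shows "X interior_of (A \<union> C) \<subseteq> X interior_of A \<union> C"
proof -
  have "openin X (X interior_of (A \<union> C) - C)"
    using assms by (simp add: openin_diff)
  moreover have "X interior_of (A \<union> C) - C \<subseteq> A"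
    using interior_of_subset[of X "A \<union> C"] by blast
  ultimately have "X interior_of (A \<union> C) - C \<subseteq> X interior_of A"
    by (rule interior_of_maximal[rotated])
  then show ?thesis by blast
qed

lemma operator_topological_space_interior_closure:
  assumes T: "\<And>A. A \<subseteq> topspace X \<Longrightarrow> T A = X interior_of (X closure_of A)"
  shows "operator_topological_space X T"
  unfolding operator_topological_space_def
proof (intro conjI allI impI)
  show "T \<in> Pow (topspace X) \<rightarrow> Pow (topspace X)"
    by (simp add: T interior_of_subset_topspace)
  fix U assume U: "openin X U"
  then have "U \<subseteq> X interior_of (X closure_of U)"
    by (simp add: closure_of_subset interior_of_maximal openin_subset)
  with U show "U \<subseteq> T U"
    by (simp add: T openin_subset)
qed

text \<open>Complementation swaps interior and closure, turning preopenness of the complement into a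
  condition on \<open>F\<close> itself.\<close>

lemma T_star_closedin_interior_closure:
  assumes T: "\<And>A. A \<subseteq> topspace X \<Longrightarrow> T A = X interior_of (X closure_of A)"
  shows "T_star_closedin X T F \<longleftrightarrow> F \<subseteq> topspace X \<and> X closure_of (X interior_of F) \<subseteq> F"
proof -
  have "T (topspace X - F) = topspace X - X closure_of (X interior_of F)"
    by (simp add: T closure_of_complement interior_of_complement)
  \<comment> \<open>The closure lies in \<open>topspace X\<close>, so inclusion of the complements
    reverses to inclusion in \<open>F\<close>.\<close>
  then show ?thesis
    using closure_of_subset_topspace[of X "X interior_of F"]
    unfolding T_star_closedin_def T_star_openin_def by auto
qed

lemma T_star_closure_of_interior_closure:
  assumes T: "\<And>A. A \<subseteq> topspace X \<Longrightarrow> T A = X interior_of (X closure_of A)"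
    and A: "A \<subseteq> topspace X"
  shows "T_star_closure_of X T A = A \<union> X closure_of (X interior_of A)"
proof
  let ?C = "X closure_of (X interior_of A)"
  \<comment> \<open>Adding the closed set \<open>?C\<close> to \<open>A\<close> creates no interior
    points outside \<open>?C\<close>, so the union is itself
    \<open>T\<^sup>*\<close>-closed.\<close>
  have "X interior_of (A \<union> ?C) \<subseteq> X interior_of A \<union> ?C"
    by (simp add: interior_of_Un_closedin_subset)
  also have "\<dots> \<subseteq> ?C"
    by (simp add: closure_of_subset interior_of_subset_topspace)
  finally have "X closure_of (X interior_of (A \<union> ?C)) \<subseteq> ?C"
    by (simp add: closure_of_minimal)
  then have "T_star_closedin X T (A \<union> ?C)"
    using A closure_of_subset_topspace[of X "X interior_of A"]
    by (auto simp: T_star_closedin_interior_closure[OF T])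
  then show "T_star_closure_of X T A \<subseteq> A \<union> ?C"
    unfolding T_star_closure_of_def by blast
  \<comment> \<open>By monotonicity \<open>?C\<close> lies in the closure of the interior of
    \<open>F\<close>, which \<open>F\<close> contains.\<close>
  have "?C \<subseteq> F" if "T_star_closedin X T F" "A \<subseteq> F" for F
    using that closure_of_mono[OF interior_of_mono[OF \<open>A \<subseteq> F\<close>], of X X]
    by (auto simp: T_star_closedin_interior_closure[OF T])
  then show "A \<union> ?C \<subseteq> T_star_closure_of X T A"
    unfolding T_star_closure_of_def by blast
qed

theorem lemma1:
  fixes X :: "'a topology" and Y :: "'b topology"
    and T :: "'a set \<Rightarrow> 'a set" and f :: "'a \<Rightarrow> 'b"
  assumes T: "\<And>A. A \<subseteq> topspace X \<Longrightarrow> T A = X interior_of (X closure_of A)"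
    and f: "f \<in> topspace X \<rightarrow> topspace Y"
  shows "weakly_almost_contra_T_star_continuous_map X T Y f \<longleftrightarrow>
    (\<forall>S V. regular_closedin Y S \<and> regular_openin Y V \<and> S \<subseteq> V \<longrightarrow>
       X closure_of (X interior_of {x \<in> topspace X. f x \<in> S}) \<subseteq> {x \<in> topspace X. f x \<in> V})"
proof -
  have "T_star_closure_of X T {x \<in> topspace X. f x \<in> S} \<subseteq> {x \<in> topspace X. f x \<in> V} \<longleftrightarrow>
      X closure_of (X interior_of {x \<in> topspace X. f x \<in> S}) \<subseteq> {x \<in> topspace X. f x \<in> V}"
    if "S \<subseteq> V" for S V
  proof -
    have "{x \<in> topspace X. f x \<in> S} \<subseteq> {x \<in> topspace X. f x \<in> V}"
      using that by blast
    then show ?thesis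
      by (simp add: T_star_closure_of_interior_closure[OF T])
  qed
  \<comment> \<open>The conditions agree pair by pair; the remaining conjuncts of the definition
    follow from \<open>f\<close> and \<open>T\<close>.\<close>
  then show ?thesis
    using f operator_topological_space_interior_closure[OF T]
    by (simp add: weakly_almost_contra_T_star_continuous_map_def) blast
qed

end
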